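(* Let $S=\{x_1,\dots,x_n\}\subset\mathbb{R}^2$ be a set of $n\ge 2$ distinct points in general position, and let $p\in\mathbb{R}^2$. Consider the problem $$M(W_2):\quad \max_{r}\ \frac1r\max_{x\in U(r)}\|x-p\| ,\qquad U(r)=\Big\{x : \max_{i}\|x-x_i\|=r\Big\},$$ which is the same as maximizing $\dfrac{\|x-p\|}{\max_i\|x-x_i\|}$ over all $x$ in the plane. If $p$ does not coincide with any vertex of the convex hull $CH(S)$, then any optimal solution of $M(W_2)$ lies on $FVB(S)$, the boundary of the farthest-point Voronoi diagram of $S$ (with $\infty$ counted as a point of $FVB(S)$).
   Context: $\|\cdot\|$ is the Euclidean norm on $\mathbb{R}^2$. $S$ is in general position if no four of its points are co-circular. For $x_i\in S$, the farthest-point Voronoi cell is $FV(x_i)=\{y\in\mathbb{R}^2:\|y-x_i\|>\|y-x_j\|\ \text{for all } x_j\in S,\ j\ne i\}$. $FVB(S)$ is the boundary of this subdivision, i.e. the set of $y\in\mathbb{R}^2$ for which the maximum $\max_i\|y-x_i\|$ is attained by at least two points of $S$. The single point $\infty$ is regarded as a special node of $FVB(S)$. Feasible solutions range over $\mathbb{R}^2\cup\{\infty\}$ (one-point compactification), and the objective $\|x-p\|/\max_i\|x-x_i\|$ takes at $x=\infty$ its limiting value $1$. *)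

theory Defs
  imports "HOL-Analysis.Analysis"
begin

type_synonym point = "real ^ 2"

(* The one-point compactification of the plane: None is the point at infinity
   (the same encoding as Alexandroff_compactification). *)
type_synonym xpoint = "point option"

definition general_position :: "point set \<Rightarrow> bool" where
  "general_position S \<longleftrightarrow>
     (\<forall>T\<subseteq>S. card T = 4 \<longrightarrow> \<not> (\<exists>c r. T \<subseteq> sphere c r))"

definition far_dist :: "point set \<Rightarrow> point \<Rightarrow> real" where
  "far_dist S y = Max ((\<lambda>s. norm (y - s)) ` S)"

definition FV :: "point set \<Rightarrow> point \<Rightarrow> point set" where
  "FV S s = {y. \<forall>t\<in>S - {s}. norm (y - s) > norm (y - t)}"

definition FVB :: "point set \<Rightarrow> point set" where
  "FVB S = {y. \<exists>s\<in>S. \<exists>t\<in>S. s \<noteq> t \<and>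
               norm (y - s) = far_dist S y \<and> norm (y - t) = far_dist S y}"

definition FVB_inf :: "point set \<Rightarrow> xpoint set" where
  "FVB_inf S = insert None (Some ` FVB S)"

lemma FVB_eq_Compl_cells:
  assumes "finite S" and "S \<noteq> {}"
  shows "FVB S = - (\<Union>s\<in>S. FV S s)"
proof -
  have le: "norm (y - s) \<le> far_dist S y" if "s \<in> S" for s y
    using assms that by (simp add: far_dist_def)
  have att: "\<exists>s\<in>S. norm (y - s) = far_dist S y" for y
  proof -
    have "far_dist S y \<in> (\<lambda>s. norm (y - s)) ` S"
      unfolding far_dist_def using assms by (intro Max_in) auto
    then show ?thesis by auto
  qed
  have "y \<in> FVB S \<longleftrightarrow> (\<forall>s\<in>S. y \<notin> FV S s)" for y
  proof
    assume "y \<in> FVB S"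
    then obtain s t where st: "s \<in> S" "t \<in> S" "s \<noteq> t"
      "norm (y - s) = far_dist S y" "norm (y - t) = far_dist S y"
      by (auto simp: FVB_def)
    show "\<forall>u\<in>S. y \<notin> FV S u"
    proof
      fix u assume u: "u \<in> S"
      obtain v where "v \<in> S - {u}" "norm (y - v) = far_dist S y"
        using st by (cases "u = s") auto
      then show "y \<notin> FV S u"
        using le[OF u, of y] unfolding FV_def mem_Collect_eq by (metis not_less)
    qed
  next
    assume h: "\<forall>s\<in>S. y \<notin> FV S s"
    obtain s where s: "s \<in> S" "norm (y - s) = far_dist S y" using att by blast
    then obtain t where t: "t \<in> S - {s}" "norm (y - s) \<le> norm (y - t)"
      using h by (force simp: FV_def)
    then have "norm (y - t) = far_dist S y" using le[of t y] s by auto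
    then show "y \<in> FVB S" using s t by (auto simp: FVB_def)
  qed
  then show ?thesis by auto
qed

fun ratio :: "point set \<Rightarrow> point \<Rightarrow> xpoint \<Rightarrow> real" where
  "ratio S p (Some x) = norm (x - p) / far_dist S x"
| "ratio S p None = 1"

lemma ratio_tendsto_at_infinity:
  assumes "finite S" and "S \<noteq> {}"
  shows "((\<lambda>x. ratio S p (Some x)) \<longlongrightarrow> ratio S p None) at_infinity"
proof -
  obtain a where a: "a \<in> S" using assms by auto
  define C where "C = Max ((\<lambda>s. norm (s - p)) ` S)"
  have bd: "norm (ratio S p (Some x) - 1) \<le> C * inverse (norm (x - a))"
    if x: "x \<noteq> a" for x
  proof -
    have 1: "norm (x - a) \<le> far_dist S x"
      using assms a by (simp add: far_dist_def)
    have "far_dist S x \<in> (\<lambda>s. norm (x - s)) ` S"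
      unfolding far_dist_def using assms by (intro Max_in) auto
    then obtain s where s: "s \<in> S" "norm (x - s) = far_dist S x" by auto
    have sp: "norm (s - p) \<le> C" "norm (a - p) \<le> C"
      using assms s a by (auto simp: C_def)
    have "norm (x - p) \<le> norm (x - a) + norm (a - p)"
      using norm_triangle_ineq[of "x - a" "a - p"] by simp
    moreover have "norm (x - s) \<le> norm (x - p) + norm (s - p)"
      using norm_triangle_ineq4[of "x - p" "s - p"] by simp
    ultimately have d: "\<bar>norm (x - p) - far_dist S x\<bar> \<le> C" using s sp 1 by linarith
    have pos: "0 < norm (x - a)" "0 < far_dist S x" using x 1 by (auto intro: less_le_trans[OF _ 1])
    have "norm (ratio S p (Some x) - 1) = \<bar>norm (x - p) - far_dist S x\<bar> / far_dist S x"
    proof -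
      have "ratio S p (Some x) - 1 = (norm (x - p) - far_dist S x) / far_dist S x"
        using pos by (simp add: diff_divide_distrib)
      then show ?thesis using pos by (simp add: abs_divide)
    qed
    also have "\<dots> \<le> C / norm (x - a)"
      using d pos 1 by (intro frac_le) auto
    finally show ?thesis by (simp add: divide_inverse)
  qed
  have "((\<lambda>x::point. C * inverse (norm (x - a))) \<longlongrightarrow> C * 0) at_infinity"
  proof (intro tendsto_mult tendsto_const)
    have "filterlim (\<lambda>x::point. norm (x + (- a))) at_top at_infinity"
      by (rule filterlim_compose[OF filterlim_norm_at_top])
         (intro tendsto_add_filterlim_at_infinity'[OF filterlim_ident tendsto_const])
    then show "((\<lambda>x::point. inverse (norm (x - a))) \<longlongrightarrow> 0) at_infinity"
      by (intro tendsto_inverse_0_at_top) simp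
  qed
  then have lim: "((\<lambda>x::point. C * inverse (norm (x - a))) \<longlongrightarrow> 0) at_infinity"
    by simp
  have ev: "eventually (\<lambda>x. norm (ratio S p (Some x) - 1) \<le> C * inverse (norm (x - a))) at_infinity"
    unfolding eventually_at_infinity
  proof (intro exI[of _ "norm a + 1"] allI impI)
    fix x :: point assume "norm a + 1 \<le> norm x"
    then have "x \<noteq> a" by auto
    then show "norm (ratio S p (Some x) - 1) \<le> C * inverse (norm (x - a))" by (rule bd)
  qed
  have "((\<lambda>x. ratio S p (Some x) - 1) \<longlongrightarrow> 0) at_infinity"
    by (rule Lim_null_comparison[OF ev lim])
  then have "((\<lambda>x. ratio S p (Some x)) \<longlongrightarrow> 1) at_infinity"
    by (rule LIM_zero_cancel)
  then show ?thesis by simp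
qed

definition ratio_optimal :: "point set \<Rightarrow> point \<Rightarrow> xpoint \<Rightarrow> bool" where
  "ratio_optimal S p x \<longleftrightarrow> is_arg_max (ratio S p) (\<lambda>_. True) x"

definition U :: "point set \<Rightarrow> real \<Rightarrow> point set" where
  "U S r = {x. far_dist S x = r}"

(* The outer variable of M(W_2) is a radius Some r, or None for the infinite
   radius, whose level set consists of the point at infinity only. *)
fun U_inf :: "point set \<Rightarrow> real option \<Rightarrow> xpoint set" where
  "U_inf S (Some r) = Some ` U S r"
| "U_inf S None = {None}"

(* U S r is compact, so for nonempty U S r the supremum is an attained maximum. *)
fun W2_value :: "point set \<Rightarrow> point \<Rightarrow> real option \<Rightarrow> real" where
  "W2_value S p (Some r) = 1 / r * (SUP x\<in>U S r. norm (x - p))"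
| "W2_value S p None = 1"

fun inner_optimal :: "point set \<Rightarrow> point \<Rightarrow> real option \<Rightarrow> xpoint \<Rightarrow> bool" where
  "inner_optimal S p (Some r) (Some x) \<longleftrightarrow> is_arg_max (\<lambda>y. norm (y - p)) (\<lambda>y. y \<in> U S r) x"
| "inner_optimal S p (Some r) None \<longleftrightarrow> False"
| "inner_optimal S p None x \<longleftrightarrow> x \<in> U_inf S None"

definition W2_optimal :: "point set \<Rightarrow> point \<Rightarrow> xpoint \<Rightarrow> bool" where
  "W2_optimal S p x \<longleftrightarrow>
     (\<exists>r. is_arg_max (W2_value S p) (\<lambda>r. U_inf S r \<noteq> {}) r \<and> inner_optimal S p r x)"

end

theory Submission
  imports Defs
begin

text \<open>If the farthest site \<open>s\<close> of a finite optimum \<open>y\<close> were unique, it would stay farthest while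
  \<open>y\<close> moves slightly towards \<open>s\<close>. The point at infinity gives \<open>norm (y - p) \<ge> norm (y - s)\<close>, and then
  moving from \<open>y\<close> towards \<open>s\<close> strictly increases \<open>norm (x - p) / norm (x - s)\<close> as soon as
  \<open>p \<noteq> s\<close>. The latter holds because a farthest site is an extreme point of the convex hull.\<close>

section \<open>Farthest distance and farthest-point cells\<close>

lemma norm_le_far_dist:
  assumes "finite S" "s \<in> S"
  shows "norm (y - s) \<le> far_dist S y"
  using assms by (simp add: far_dist_def)

lemma far_dist_attained:
  assumes "finite S" "S \<noteq> {}"
  obtains s where "s \<in> S" "norm (y - s) = far_dist S y"
proof -
  have "far_dist S y \<in> (\<lambda>s. norm (y - s)) ` S"
    unfolding far_dist_def using assms by (intro Max_in) auto
  then show ?thesis using that by auto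
qed

text \<open>This keeps every denominator positive, so no finite value of \<open>ratio\<close> comes
  from the convention for division by zero.\<close>

lemma far_dist_pos:
  assumes "finite S" "card S \<ge> 2"
  shows "far_dist S y > 0"
proof -
  have "\<not> S \<subseteq> {y}"
    using assms card_mono[of "{y}" S] by auto
  then obtain s where s: "s \<in> S" "s \<noteq> y" by auto
  then have "0 < norm (y - s)" by simp
  also have "\<dots> \<le> far_dist S y" using assms s by (simp add: norm_le_far_dist)
  finally show ?thesis .
qed

lemma far_dist_eqI:
  assumes "finite S" "s \<in> S" "y \<in> FV S s"
  shows "far_dist S y = norm (y - s)"
proof -
  have "norm (y - t) \<le> norm (y - s)" if "t \<in> S" for t
    using assms that by (cases "t = s") (auto simp: FV_def less_imp_le)
  then show ?thesis
    unfolding far_dist_def using assms by (intro Max_eqI) auto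
qed

text \<open>Each condition against another site cuts out an open half-plane, and finitely many of
  them are intersected.\<close>

lemma open_FV:
  assumes "finite S"
  shows "open (FV S s)"
proof -
  have "FV S s = (\<Inter>t\<in>S - {s}. {y. norm (y - t) < norm (y - s)})"
    by (auto simp: FV_def)
  also have "open \<dots>"
    using assms by (intro open_INT open_Collect_less ballI continuous_intros) auto
  finally show ?thesis .
qed

section \<open>Agreement of the two-stage problem with the maximization of the ratio\<close>

text \<open>A closed set, the common part of the balls, meets a finite union of spheres, which is
  compact. This makes the maximum over a nonempty level attained and the \<open>SUP\<close> in
  \<open>W2_value\<close> meaningful.\<close>

lemma compact_U:
  assumes "finite S" "S \<noteq> {}"
  shows "compact (U S r)"
proof -
  have "U S r = (\<Inter>s\<in>S. cball s r) \<inter> (\<Union>s\<in>S. sphere s r)"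
  proof (intro equalityI subsetI)
    fix y assume "y \<in> U S r"
    then have y: "far_dist S y = r" by (simp add: U_def)
    obtain s where "s \<in> S" "norm (y - s) = r"
      using far_dist_attained[OF assms, of y] y by auto
    then show "y \<in> (\<Inter>s\<in>S. cball s r) \<inter> (\<Union>s\<in>S. sphere s r)"
      using norm_le_far_dist[OF assms(1), of _ y] y by (auto simp: dist_norm norm_minus_commute)
  next
    fix y assume "y \<in> (\<Inter>s\<in>S. cball s r) \<inter> (\<Union>s\<in>S. sphere s r)"
    then obtain s where s: "s \<in> S" "norm (y - s) = r" and le: "\<And>t. t \<in> S \<Longrightarrow> norm (y - t) \<le> r"
      by (auto simp: dist_norm norm_minus_commute)
    have "far_dist S y = r"
      unfolding far_dist_def using assms s le by (intro Max_eqI) auto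
    then show "y \<in> U S r" by (simp add: U_def)
  qed
  also have "compact \<dots>"
    using assms by (intro closed_Int_compact closed_INT compact_UN) auto
  finally show ?thesis .
qed

lemma W2_value_ge_ratio:
  assumes "finite S" "S \<noteq> {}" "far_dist S x = r" "r > 0"
  shows "ratio S p (Some x) \<le> W2_value S p (Some r)"
proof -
  \<comment> \<open>A real \<open>SUP\<close> is known to be an upper bound only if the set is
    bounded above.\<close>
  have "bdd_above ((\<lambda>x. norm (x - p)) ` U S r)"
    by (intro bounded_imp_bdd_above compact_imp_bounded compact_continuous_image
        continuous_intros compact_U assms)
  then have "norm (x - p) \<le> (SUP x\<in>U S r. norm (x - p))"
    using assms by (intro cSUP_upper) (auto simp: U_def)
  then show ?thesis using assms by (simp add: divide_right_mono)
qed

lemma W2_value_eq_ratio: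
  assumes "is_arg_max (\<lambda>y. norm (y - p)) (\<lambda>y. y \<in> U S r) x"
  shows "W2_value S p (Some r) = ratio S p (Some x)"
proof -
  have "(SUP x\<in>U S r. norm (x - p)) = norm (x - p)"
    using assms by (intro cSup_eq_maximum) (auto simp: is_arg_max_linorder)
  then show ?thesis using assms by (simp add: is_arg_max_def U_def)
qed

lemma inner_optimal_exists:
  assumes "finite S" "S \<noteq> {}" "U_inf S r \<noteq> {}"
  obtains x where "inner_optimal S p r x"
proof (cases r)
  case None
  then show ?thesis using that[of None] by simp
next
  case (Some \<rho>)
  have "\<exists>x\<in>U S \<rho>. \<forall>y\<in>U S \<rho>. norm (y - p) \<le> norm (x - p)"
    using assms Some
    by (intro continuous_attains_sup compact_U continuous_intros) auto
  then obtain x where "x \<in> U S \<rho>" "\<forall>y\<in>U S \<rho>. norm (y - p) \<le> norm (x - p)" by blast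
  then show ?thesis using that[of "Some x"] Some by (simp add: is_arg_max_linorder)
qed

lemma W2_value_eq_ratio_if_inner_optimal:
  assumes "inner_optimal S p r x"
  shows "W2_value S p r = ratio S p x"
proof (cases r)
  case None
  then show ?thesis using assms by simp
next
  case (Some \<rho>)
  then obtain y where "x = Some y" "is_arg_max (\<lambda>y. norm (y - p)) (\<lambda>y. y \<in> U S \<rho>) y"
    using assms by (cases x) auto
  then show ?thesis using Some W2_value_eq_ratio by blast
qed

lemma ratio_le_W2_value:
  assumes "finite S" "card S \<ge> 2"
  obtains r where "U_inf S r \<noteq> {}" "x \<in> U_inf S r" "ratio S p x \<le> W2_value S p r"
proof (cases x)
  case None
  then show ?thesis using that[of None] by simp
next
  case (Some y)
  have "S \<noteq> {}" using assms by auto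
  then show ?thesis
    using that[of "Some (far_dist S y)"] Some assms
      W2_value_ge_ratio[of S y _ p] far_dist_pos[of S y]
    by (auto simp: U_def simp del: ratio.simps(1) W2_value.simps(1))
qed

text \<open>The value of a nonempty level is the ratio at an inner optimum of it, and each point's
  ratio is at most the value of a level containing that point. Hence maximizing level by level and
  maximizing at once give the same optima.\<close>

lemma W2_optimal_iff_ratio_optimal:
  assumes "finite S" "card S \<ge> 2"
  shows "W2_optimal S p x \<longleftrightarrow> ratio_optimal S p x"
proof
  assume "W2_optimal S p x"
  then obtain r where r: "is_arg_max (W2_value S p) (\<lambda>r. U_inf S r \<noteq> {}) r" "inner_optimal S p r x"
    by (auto simp: W2_optimal_def)
  have "ratio S p z \<le> ratio S p x" for z
  proof -
    obtain q where "U_inf S q \<noteq> {}" and q: "ratio S p z \<le> W2_value S p q"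
      using ratio_le_W2_value[OF assms] .
    then have "W2_value S p q \<le> W2_value S p r"
      using r(1) unfolding is_arg_max_linorder by blast
    then show ?thesis using q W2_value_eq_ratio_if_inner_optimal[OF r(2)] by simp
  qed
  then show "ratio_optimal S p x" by (simp add: ratio_optimal_def is_arg_max_linorder)
next
  assume "ratio_optimal S p x"
  then have opt: "ratio S p z \<le> ratio S p x" for z
    by (simp add: ratio_optimal_def is_arg_max_linorder)
  have ne: "S \<noteq> {}" using assms by auto
  obtain r where r: "U_inf S r \<noteq> {}" "x \<in> U_inf S r" "ratio S p x \<le> W2_value S p r"
    using ratio_le_W2_value[OF assms] .
  have le: "W2_value S p q \<le> ratio S p x" if "U_inf S q \<noteq> {}" for q
  proof -
    obtain z where "inner_optimal S p q z" using inner_optimal_exists[OF assms(1) ne \<open>U_inf S q \<noteq> {}\<close>] .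
    then show ?thesis using W2_value_eq_ratio_if_inner_optimal opt by metis
  qed
  have inner: "inner_optimal S p r x"
  proof (cases r)
    case None
    then show ?thesis using r by simp
  next
    case (Some \<rho>)
    then obtain y where y: "x = Some y" "far_dist S y = \<rho>" using r by (auto simp: U_def)
    \<comment> \<open>On this level the denominator is the constant \<open>\<rho>\<close>, which is
      positive, so comparing ratios amounts to comparing numerators.\<close>
    have "norm (z - p) \<le> norm (y - p)" if "z \<in> U S \<rho>" for z
      using opt[of "Some z"] y that far_dist_pos[OF assms, of y]
      by (auto simp: U_def divide_le_cancel)
    then show ?thesis using Some y by (auto simp: is_arg_max_linorder U_def)
  qed
  have "is_arg_max (W2_value S p) (\<lambda>r. U_inf S r \<noteq> {}) r"
    unfolding is_arg_max_linorder using r(1) order_trans[OF le r(3)] by blast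
  then show "W2_optimal S p x" using inner by (auto simp: W2_optimal_def)
qed

section \<open>Optimal solutions lie on the farthest-point Voronoi boundary\<close>

text \<open>A point inside a segment is strictly closer to \<open>c\<close> than one of the
  endpoints, so it cannot be at distance \<open>r\<close> when both endpoints are within
  \<open>r\<close>.\<close>

lemma sphere_extreme_point_of_cball:
  fixes c s :: "'a :: euclidean_space"
  assumes "s \<in> sphere c r"
  shows "s extreme_point_of (cball c r)"
  unfolding extreme_point_of_def
proof (intro conjI ballI notI)
  show "s \<in> cball c r" using assms by simp
  fix a b assume "a \<in> cball c r" "b \<in> cball c r" "s \<in> open_segment a b"
  then show False using assms dist_decreases_open_segment[of s a b c] by auto
qed

text \<open>The hull lies in the ball around \<open>y\<close> whose sphere passes through
  \<open>s\<close>, and an extreme point of a set stays extreme in any subset containing it.\<close>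

lemma farthest_site_extreme:
  assumes "finite S" "s \<in> S" "norm (y - s) = far_dist S y"
  shows "s extreme_point_of (convex hull S)"
proof -
  have "convex hull S \<subseteq> cball y (far_dist S y)"
    using norm_le_far_dist[OF assms(1), of _ y]
    by (intro hull_minimal) (auto simp: dist_norm)
  moreover have "s extreme_point_of (cball y (far_dist S y))"
    using assms by (intro sphere_extreme_point_of_cball) (simp add: dist_norm)
  ultimately show ?thesis
    using hull_inc[OF assms(2), of convex] by (auto simp: extreme_point_of_def)
qed

text \<open>The move scales the denominator by exactly \<open>1 - t\<close>, so it suffices that the
  numerator becomes larger than \<open>1 - t\<close> times its old value.\<close>

lemma ratio_increases_towards_site:
  fixes y p s :: "'a :: real_inner"
  assumes "norm (y - s) \<le> norm (y - p)" "p \<noteq> s" "y \<noteq> s" "0 < t" "t < 1"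
  defines "x \<equiv> y + t *\<^sub>R (s - y)"
  shows "norm (y - p) / norm (y - s) < norm (x - p) / norm (x - s)"
proof -
  have xs: "norm (x - s) = (1 - t) * norm (y - s)"
  proof -
    have "x - s = (1 - t) *\<^sub>R (y - s)" by (simp add: x_def algebra_simps)
    then show ?thesis using assms by simp
  qed
  \<comment> \<open>Expand the square of
    \<open>x - p = (1 - t) *\<^sub>R (y - p) + t *\<^sub>R (s - p)\<close> and replace the inner
    product by the law of cosines in the triangle \<open>y\<close>, \<open>p\<close>,
    \<open>s\<close>.\<close>
  have "(norm (x - p))\<^sup>2 - ((1 - t) * norm (y - p))\<^sup>2
      = t * (1 - t) * ((norm (y - p))\<^sup>2 - (norm (y - s))\<^sup>2) + t * (norm (s - p))\<^sup>2"
    unfolding x_def power_mult_distrib power2_norm_eq_inner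
    by (simp add: inner_simps inner_commute algebra_simps power2_eq_square)
  moreover have "(norm (y - s))\<^sup>2 \<le> (norm (y - p))\<^sup>2"
    using assms by (simp add: power_mono)
  then have "0 \<le> t * (1 - t) * ((norm (y - p))\<^sup>2 - (norm (y - s))\<^sup>2)" using assms by simp
  moreover have "0 < t * (norm (s - p))\<^sup>2" using assms by simp
  ultimately have "((1 - t) * norm (y - p))\<^sup>2 < (norm (x - p))\<^sup>2" by linarith
  then have "(1 - t) * norm (y - p) < norm (x - p)" by (rule power_less_imp_less_base) simp
  then have "norm (y - p) < norm (x - p) / (1 - t)"
    using assms by (simp add: less_divide_eq mult.commute)
  then have "norm (y - p) / norm (y - s) < norm (x - p) / (1 - t) / norm (y - s)"
    using assms(3) by (intro divide_strict_right_mono) auto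
  then show ?thesis by (simp add: xs)
qed

lemma ratio_optimal_in_FVB_inf:
  assumes "finite S" "card S \<ge> 2" "\<not> p extreme_point_of (convex hull S)"
    and "ratio_optimal S p x"
  shows "x \<in> FVB_inf S"
proof (rule ccontr)
  assume contra: "x \<notin> FVB_inf S"
  have ne: "S \<noteq> {}" using assms by auto
  have opt: "ratio S p z \<le> ratio S p x" for z
    using assms by (simp add: ratio_optimal_def is_arg_max_linorder)
  obtain y where x: "x = Some y" and "y \<notin> FVB S"
    using contra by (cases x) (auto simp: FVB_inf_def)
  then obtain s where s: "s \<in> S" "y \<in> FV S s"
    using FVB_eq_Compl_cells[OF assms(1) ne] by auto
  have far: "far_dist S y = norm (y - s)" using far_dist_eqI[OF assms(1) s] .
  have ys: "y \<noteq> s" using far far_dist_pos[OF assms(1,2), of y] by auto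
  have ps: "p \<noteq> s" using farthest_site_extreme[OF assms(1) s(1), of y] far assms by auto
  have yp: "norm (y - s) \<le> norm (y - p)"
    using opt[of None] x far ys by (simp add: le_divide_eq)
  \<comment> \<open>The one-sided limit combines the openness of the cell with the constraint
    \<open>0 < t < 1\<close> and yields one admissible step length.\<close>
  have "((\<lambda>t. y + t *\<^sub>R (s - y)) \<longlongrightarrow> y + 0 *\<^sub>R (s - y)) (at_right 0)"
    by (intro tendsto_intros)
  then have "eventually (\<lambda>t. y + t *\<^sub>R (s - y) \<in> FV S s) (at_right 0)"
    using topological_tendstoD[OF _ open_FV[OF assms(1)]] s by simp
  moreover have "eventually (\<lambda>t::real. 0 < t \<and> t < 1) (at_right 0)"
    using eventually_at_right_real[of 0 "1::real"] by simp
  ultimately have "eventually (\<lambda>t. y + t *\<^sub>R (s - y) \<in> FV S s \<and> 0 < t \<and> t < 1) (at_right 0)"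
    by (rule eventually_conj)
  then obtain t where t: "y + t *\<^sub>R (s - y) \<in> FV S s" "0 < t" "t < 1"
    using eventually_happens'[OF trivial_limit_at_right_real[of 0]] by blast
  \<comment> \<open>Both points lie in the cell of \<open>s\<close>, so at both of them
    \<open>far_dist S\<close> is the distance to \<open>s\<close>.\<close>
  have "ratio S p x < ratio S p (Some (y + t *\<^sub>R (s - y)))"
    using ratio_increases_towards_site[OF yp ps ys t(2,3)]
    by (simp only: x ratio.simps far far_dist_eqI[OF assms(1) s(1) t(1)])
  then show False using opt[of "Some (y + t *\<^sub>R (s - y))"] by linarith
qed

text \<open>Vertices of the hull are expressed as its extreme points, which also covers collinear
  sites.\<close>

theorem theorem3p1:
  fixes S :: "(real ^ 2) set" and p :: "real ^ 2" and n :: nat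
  assumes "finite S" and "card S = n" and "n \<ge> 2"
    and "general_position S"
    and "\<not> p extreme_point_of (convex hull S)"
  shows "(\<forall>x. W2_optimal S p x \<longleftrightarrow> ratio_optimal S p x) \<and>
         (\<forall>x. W2_optimal S p x \<longrightarrow> x \<in> FVB_inf S)"
  using assms W2_optimal_iff_ratio_optimal ratio_optimal_in_FVB_inf by blast

end
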